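(* For all $n,j\in\mathbb{N}_0$ and every positive integer $\gamma$, the number of unbalanced Jacobi-Stirling permutation pairs $(\pi_1,\pi_2)$ of length $n$ (with parameter $\gamma$) in which $\pi_2$ has exactly $j$ cycles is $\genfrac{[}{]}{0pt}{}{n}{j}_{\gamma}$.
   Context: $\mathbb{N}=\{1,2,3,\dots\}$, $\mathbb{N}_0=\{0,1,2,\dots\}$; $S_m$ is the group of permutations of $\{1,\ldots,m\}$. **Jacobi-Stirling numbers of the first kind (signless).** $\genfrac{[}{]}{0pt}{}{n}{j}_{\gamma}$ ($n,j\in\mathbb{N}_0$) is defined by the polynomial identity in $x$ $$\prod_{m=0}^{n-1}\bigl(x-m(m+2\gamma-1)\bigr)=\sum_{j=0}^{n}(-1)^{n+j}\genfrac{[}{]}{0pt}{}{n}{j}_{\gamma}x^{j}$$ (empty product equal to $1$), with $\genfrac{[}{]}{0pt}{}{n}{j}_{\gamma}=0$ for $j>n$. **Cycles and cycle maxima.** Cycles of a permutation include fixed points (cycles of length $1$). The cycle maxima of a permutation are the numbers which are largest in their cycles. **Unbalanced Jacobi-Stirling permutation pairs.** An unbalanced Jacobi-Stirling permutation pair of length $n$ (with parameter $\gamma$) is an ordered pair $(\pi_1,\pi_2)$ with $\pi_1\in S_{n+2\gamma-1}$ and $\pi_2\in S_n$ such that: 1. $\pi_1$ has $2\gamma-1$ more cycles than $\pi_2$; 2. the cycle maxima of $\pi_1$ which are less than $n+1$ are exactly the cycle maxima of $\pi_2$. *)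

theory Defs
  imports "HOL-Combinatorics.Orbits" "HOL-Computational_Algebra.Polynomial"
begin

definition jacobi_stirling_poly :: "'a::comm_ring_1 \<Rightarrow> nat \<Rightarrow> 'a poly" where
  "jacobi_stirling_poly \<gamma> n =
     (\<Prod>m<n. [:0, 1:] - [:of_nat m * (of_nat m + 2 * \<gamma> - 1):])"

text \<open>
  Signless Jacobi-Stirling numbers of the first kind. Since the sign is its own inverse, they
  are read off as signed coefficients; the next three lemmas show that they satisfy, and are the
  only numbers satisfying, the defining polynomial identity.
\<close>
definition jacobi_stirling1 :: "'a::comm_ring_1 \<Rightarrow> nat \<Rightarrow> nat \<Rightarrow> 'a" where
  "jacobi_stirling1 \<gamma> n j = (-1) ^ (n + j) * coeff (jacobi_stirling_poly \<gamma> n) j"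

lemma degree_jacobi_stirling_poly_le: "degree (jacobi_stirling_poly \<gamma> n) \<le> n"
proof -
  have "degree (jacobi_stirling_poly \<gamma> n) \<le>
      (\<Sum>m<n. degree ([:0, 1:] - [:of_nat m * (of_nat m + 2 * \<gamma> - 1):]))"
    unfolding jacobi_stirling_poly_def by (rule degree_prod_sum_le[simplified comp_def]) simp
  also have "\<dots> \<le> (\<Sum>m<n. 1)"
    by (rule sum_mono) simp
  finally show ?thesis by simp
qed

lemma jacobi_stirling1_eq_0: "n < j \<Longrightarrow> jacobi_stirling1 \<gamma> n j = 0"
  using degree_jacobi_stirling_poly_le[of \<gamma> n]
  by (simp add: jacobi_stirling1_def coeff_eq_0)

lemma jacobi_stirling1_identity_iff:
  fixes c :: "nat \<Rightarrow> 'a::comm_ring_1"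
  assumes "\<And>j. n < j \<Longrightarrow> c j = 0"
  shows "(\<Prod>m<n. [:0, 1:] - [:of_nat m * (of_nat m + 2 * \<gamma> - 1):]) =
           (\<Sum>j\<le>n. monom ((-1) ^ (n + j) * c j) j)
         \<longleftrightarrow> (\<forall>j. c j = jacobi_stirling1 \<gamma> n j)"
    (is "?P = ?S \<longleftrightarrow> _")
proof -
  have S: "coeff ?S j = (-1) ^ (n + j) * c j" for j
    using assms by (cases "j \<le> n") (auto simp: coeff_sum)
  have sgn: "(-1) ^ k * ((-1) ^ k * x) = x" for k and x :: 'a
    by (simp flip: mult.assoc power_add)
  have "?P = ?S \<longleftrightarrow> (\<forall>j. coeff (jacobi_stirling_poly \<gamma> n) j = (-1) ^ (n + j) * c j)"
    unfolding jacobi_stirling_poly_def[symmetric] poly_eq_iff S ..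
  also have "\<dots> \<longleftrightarrow> (\<forall>j. c j = jacobi_stirling1 \<gamma> n j)"
    unfolding jacobi_stirling1_def by (metis sgn)
  finally show ?thesis .
qed

text \<open>
  Permutations of \<open>{1..m}\<close> are functions \<open>p\<close> with \<open>p permutes {1..m}\<close>, so they fix every number
  outside \<open>{1..m}\<close>; hence the explicit ground set in the following definitions. A fixed point
  \<open>i\<close> in the ground set contributes the cycle \<open>{i}\<close>.
\<close>
definition cycles_on :: "'a set \<Rightarrow> ('a \<Rightarrow> 'a) \<Rightarrow> 'a set set" where
  "cycles_on A p = orbit p ` A"

definition cycle_maxima_on :: "'a::linorder set \<Rightarrow> ('a \<Rightarrow> 'a) \<Rightarrow> 'a set" where
  "cycle_maxima_on A p = {i \<in> A. \<forall>k \<in> orbit p i. k \<le> i}"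

text \<open>Intended for \<open>\<gamma> \<ge> 1\<close>, so that the subtractions do not truncate.\<close>
definition unbalanced_jacobi_stirling_pairs ::
    "nat \<Rightarrow> nat \<Rightarrow> ((nat \<Rightarrow> nat) \<times> (nat \<Rightarrow> nat)) set" where
  "unbalanced_jacobi_stirling_pairs \<gamma> n =
     {(\<pi>1, \<pi>2).
        \<pi>1 permutes {1..n + 2 * \<gamma> - 1} \<and> \<pi>2 permutes {1..n} \<and>
        card (cycles_on {1..n + 2 * \<gamma> - 1} \<pi>1) = card (cycles_on {1..n} \<pi>2) + (2 * \<gamma> - 1) \<and>
        {i \<in> cycle_maxima_on {1..n + 2 * \<gamma> - 1} \<pi>1. i < n + 1} = cycle_maxima_on {1..n} \<pi>2}"

lemma finite_unbalanced_jacobi_stirling_pairs: "finite (unbalanced_jacobi_stirling_pairs \<gamma> n)"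
proof (rule finite_subset)
  show "unbalanced_jacobi_stirling_pairs \<gamma> n \<subseteq>
      {p. p permutes {1..n + 2 * \<gamma> - 1}} \<times> {p. p permutes {1..n}}"
    by (auto simp: unbalanced_jacobi_stirling_pairs_def)
qed (intro finite_cartesian_product finite_permutations finite_atLeastAtMost)

end

theory Submission
  imports Defs
begin

text \<open>
  Both components of a pair are governed by one set, the set \<open>M\<close> of cycle maxima of \<open>\<pi>2\<close>. A
  permutation has as many cycles as cycle maxima, and every cycle maximum of \<open>\<pi>1\<close> that is at most
  \<open>n\<close> belongs to \<open>M\<close>. So the \<open>2 * \<gamma> - 1\<close> additional cycles of \<open>\<pi>1\<close> have their maxima among the
  \<open>2 * \<gamma> - 1\<close> numbers above \<open>n\<close>, and all of these are cycle maxima. The set of cycle maxima of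
  \<open>\<pi>1\<close> is therefore exactly \<open>M\<close> together with the numbers above \<open>n\<close>.

  Permutations with a prescribed set of cycle maxima are counted by building the cycles from the
  largest element downwards (\<open>card_permutes_cycle_maxima_on\<close>): a cycle maximum opens a new cycle,
  in one way, whereas any other element is inserted right before one of the larger elements,
  which are all present already. For a given \<open>M\<close>, an element \<open>i \<le> n\<close> outside \<open>M\<close> thus contributes
  a factor \<open>n - i\<close> to the choice of \<open>\<pi>2\<close> and a factor \<open>n - i + 2 * \<gamma> - 1\<close> to that of \<open>\<pi>1\<close>. With
  \<open>m = n - i\<close> their product is the root \<open>m * (m + 2 * \<gamma> - 1)\<close> of the Jacobi-Stirling polynomial.
  Summed over all \<open>M\<close> with \<open>j\<close> elements, the products give the elementary symmetric function of
  degree \<open>n - j\<close> in the roots, which up to sign is the coefficient of \<open>x ^ j\<close>.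
\<close>

section \<open>Cycles and cycle maxima\<close>

lemma cycle_maxima_on_subset: "cycle_maxima_on A p \<subseteq> A"
  by (auto simp: cycle_maxima_on_def)

lemma card_cycles_on_eq_card_cycle_maxima_on:
  assumes p: "p permutes A" and fin: "finite A"
  shows "card (cycles_on A p) = card (cycle_maxima_on A p)"
proof -
  have perm: "permutation p"
    using assms by (auto simp: permutation_permutes)
  have self: "x \<in> orbit p x" for x
    using permutation_self_in_orbit[OF perm] .
  have orbit_eq: "orbit p y = orbit p x" if "y \<in> orbit p x" for x y
    using orbit_cyclic_eq3[OF cyclic_on_orbit'[OF perm] that] .
  have "bij_betw (orbit p) (cycle_maxima_on A p) (cycles_on A p)"
    unfolding bij_betw_def
  proof
    show "inj_on (orbit p) (cycle_maxima_on A p)"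
      using self by (intro inj_onI antisym) (auto simp: cycle_maxima_on_def)
    show "orbit p ` cycle_maxima_on A p = cycles_on A p"
      unfolding cycles_on_def
    proof
      show "orbit p ` cycle_maxima_on A p \<subseteq> orbit p ` A"
        using cycle_maxima_on_subset by (rule image_mono)
      show "orbit p ` A \<subseteq> orbit p ` cycle_maxima_on A p"
      proof
        fix C assume "C \<in> orbit p ` A"
        then obtain x where x: "x \<in> A" "C = orbit p x"
          by blast
        have CA: "C \<subseteq> A" and ne: "C \<noteq> {}"
          using permutes_orbit_subset[OF p x(1)] x(2) self by auto
        then have finC: "finite C"
          using fin by (auto intro: finite_subset)
        have mC: "Max C \<in> C"
          using Max_in[OF finC ne] .
        with x orbit_eq have C: "orbit p (Max C) = C"
          by blast
        have "Max C \<in> cycle_maxima_on A p"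
          using mC CA Max_ge[OF finC] by (auto simp: cycle_maxima_on_def C)
        with C show "C \<in> orbit p ` cycle_maxima_on A p"
          by (metis imageI)
      qed
    qed
  qed
  then show ?thesis
    by (simp add: bij_betw_same_card)
qed

section \<open>Counting permutations by their cycle maxima\<close>

text \<open>
  Composing with \<open>transpose b c\<close> redirects the arrow that entered \<open>c\<close> to the new element \<open>b\<close> and
  sends \<open>b\<close> to \<open>c\<close>; for \<open>c = b\<close> it leaves \<open>b\<close> alone in its cycle. Hence the cycles through old
  elements change at most by the additional element \<open>b\<close>.
\<close>
lemma orbit_transpose_comp:
  assumes q: "q permutes A" and b: "b \<notin> A" and x: "x \<in> A"
  shows "orbit (transpose b c \<circ> q) x - {b} = orbit q x"
proof
  let ?p = "transpose b c \<circ> q"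
  have inA: "y \<in> A" if "y \<in> orbit q x" for y
    using permutes_orbit_subset[OF q x] that by blast
  have ne: "q y \<noteq> b" if "y \<in> A" for y
    using that b permutes_in_image[OF q] by metis
  have qb: "q b = b"
    using q b by (simp add: permutes_def)
  show "orbit ?p x - {b} \<subseteq> orbit q x"
  proof -
    have "y \<in> orbit q x \<or> y = b \<and> (c \<in> orbit q x \<or> c = b)" if "y \<in> orbit ?p x" for y
      using that
    proof induction
      case base
      show ?case
        using ne[OF x] orbit.base[of q x] by (auto simp: transpose_def)
    next
      case (step y)
      then show ?case
        using ne[OF inA] orbit.step[of y q x] qb by (auto simp: transpose_def)
    qed
    then show ?thesis
      by blast
  qed
  show "orbit q x \<subseteq> orbit ?p x - {b}"
  proof -
    have next_in: "q y \<in> orbit ?p x" if y: "y \<in> A" and p: "?p y \<in> orbit ?p x" for y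
    proof (cases "q y = c")
      case True
      then have "?p y = b"
        by simp
      with p have "?p b \<in> orbit ?p x"
        by (metis orbit.step)
      with True qb show ?thesis
        by simp
    next
      case False
      with ne[OF y] p show ?thesis
        by simp
    qed
    have "y \<in> orbit ?p x" if "y \<in> orbit q x" for y
      using that
    proof induction
      case base
      show ?case
        using next_in[OF x orbit.base] .
    next
      case (step y)
      show ?case
        using next_in[OF inA[OF step.hyps] orbit.step[OF step.IH]] .
    qed
    with inA b show ?thesis
      by blast
  qed
qed

text \<open>
  A new smallest element never dethrones an old maximum, and it is a maximum itself only if it is
  alone in its cycle.
\<close>
lemma cycle_maxima_on_transpose_comp:
  fixes b :: "'a::linorder"
  assumes q: "q permutes A" and b: "\<forall>a\<in>A. b < a" and c: "c \<in> insert b A"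
  shows "cycle_maxima_on (insert b A) (transpose b c \<circ> q) =
    (if c = b then insert b (cycle_maxima_on A q) else cycle_maxima_on A q)"
proof -
  let ?p = "transpose b c \<circ> q"
  have bA: "b \<notin> A"
    using b by blast
  then have qb: "q b = b"
    using q by (simp add: permutes_def)
  have old: "(\<forall>k\<in>orbit ?p x. k \<le> x) \<longleftrightarrow> (\<forall>k\<in>orbit q x. k \<le> x)" if "x \<in> A" for x
    using orbit_transpose_comp[OF q bA that, of c] b that less_imp_le by blast
  have new: "(\<forall>k\<in>orbit ?p b. k \<le> b) \<longleftrightarrow> c = b"
  proof
    assume "\<forall>k\<in>orbit ?p b. k \<le> b"
    moreover have "c \<in> orbit ?p b"
      using orbit.base[of ?p b] qb by simp
    ultimately show "c = b"
      using b c by fastforce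
  next
    assume "c = b"
    then have "orbit ?p b = {b}"
      using qb by (simp add: orbit_eq_singleton_iff)
    then show "\<forall>k\<in>orbit ?p b. k \<le> b"
      by simp
  qed
  show ?thesis
    using old new by (auto simp: cycle_maxima_on_def)
qed

text \<open>
  Adding elements in decreasing order makes the choices independent: the set of maxima found so far
  never depends on which older element the new smallest one is placed before. A factor is zero
  exactly when the largest element of \<open>A\<close> is missing from \<open>M\<close>, as then no such permutation exists.
\<close>
theorem card_permutes_cycle_maxima_on:
  fixes A :: "'a::linorder set"
  assumes "finite A" and "M \<subseteq> A"
  shows "card {p. p permutes A \<and> cycle_maxima_on A p = M} = (\<Prod>i\<in>A - M. card {k\<in>A. i < k})"
  using assms
proof (induction A arbitrary: M rule: finite_linorder_min_induct)
  case empty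
  then have "{p. p permutes {} \<and> cycle_maxima_on {} p = M} = {id}"
    by (auto simp: cycle_maxima_on_def)
  then show ?case
    by simp
next
  case (insert b A)
  let ?P = "\<lambda>A M. {p. p permutes A \<and> cycle_maxima_on A p = M}"
  let ?g = "\<lambda>(c, q). transpose b c \<circ> q"
  have bA: "b \<notin> A"
    using insert.hyps(2) by blast
  have fix_b: "q b = b" if "q permutes A" for q
    using that bA by (simp add: permutes_def)
  have inj: "inj_on ?g (UNIV \<times> {q. q permutes A})"
  proof (rule inj_onI, clarify)
    fix c q d r
    assume qr: "q permutes A" "r permutes A" and eq: "transpose b c \<circ> q = transpose b d \<circ> r"
    from fun_cong[OF eq, of b] qr have "c = d"
      by (simp add: fix_b)
    moreover from this eq have "q = r"
      by (metis comp_assoc transpose_comp_involutory id_comp)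
    ultimately show "c = d \<and> q = r" ..
  qed
  have perms: "{p. p permutes insert b A} = ?g ` (insert b A \<times> {q. q permutes A})"
    unfolding permutes_insert by (rule arg_cong[of _ _ "image ?g"]) auto
  have maxima: "cycle_maxima_on (insert b A) (?g (c, q)) =
      (if c = b then insert b (cycle_maxima_on A q) else cycle_maxima_on A q)"
    if "c \<in> insert b A" "q permutes A" for c q
    using cycle_maxima_on_transpose_comp[OF that(2) insert.hyps(2) that(1)] by simp
  have b_notin: "b \<notin> cycle_maxima_on A q" for q
    using bA cycle_maxima_on_subset by blast
  \<comment> \<open>The images of \<open>b\<close> that are compatible with \<open>M\<close>: alone in its cycle, or before an old element.\<close>
  define C where "C = (if b \<in> M then {b} else A)"
  have maxima_eq_iff: "cycle_maxima_on (insert b A) (?g (c, q)) = M \<longleftrightarrow>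
      c \<in> C \<and> cycle_maxima_on A q = M - {b}" if "c \<in> insert b A" "q permutes A" for c q
    unfolding maxima[OF that] using that b_notin[of q] bA by (auto simp: C_def)
  have "?P (insert b A) M = ?g ` (C \<times> ?P A (M - {b}))"
  proof -
    have "?P (insert b A) M = {p \<in> {p. p permutes insert b A}. cycle_maxima_on (insert b A) p = M}"
      by simp
    also have "\<dots> = ?g ` {(c, q) \<in> insert b A \<times> {q. q permutes A}.
        cycle_maxima_on (insert b A) (?g (c, q)) = M}"
      unfolding perms by auto
    also have "{(c, q) \<in> insert b A \<times> {q. q permutes A}.
        cycle_maxima_on (insert b A) (?g (c, q)) = M} = C \<times> ?P A (M - {b})"
    proof -
      have "C \<subseteq> insert b A"
        by (auto simp: C_def)
      then show ?thesis
        using maxima_eq_iff by blast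
    qed
    finally show ?thesis .
  qed
  moreover have "inj_on ?g (C \<times> ?P A (M - {b}))"
    using inj by (rule inj_on_subset) auto
  ultimately have "card (?P (insert b A) M) = card C * card (?P A (M - {b}))"
    by (simp add: card_image card_cartesian_product)
  also have "card (?P A (M - {b})) = (\<Prod>i\<in>A - M. card {k\<in>A. i < k})"
  proof -
    have "M - {b} \<subseteq> A" and "A - (M - {b}) = A - M"
      using insert.prems bA by auto
    then show ?thesis
      using insert.IH[of "M - {b}"] by simp
  qed
  also have "\<dots> = (\<Prod>i\<in>A - M. card {k\<in>insert b A. i < k})"
    using insert.hyps(2) by (intro prod.cong refl arg_cong[of _ _ card]) force
  also have "card C * \<dots> = (\<Prod>i\<in>insert b A - M. card {k\<in>insert b A. i < k})"
  proof (cases "b \<in> M")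
    case True
    then show ?thesis
      by (simp add: C_def insert_Diff_if)
  next
    case False
    have "{k\<in>insert b A. b < k} = A"
      using insert.hyps(2) by auto
    then show ?thesis
      using False bA insert.hyps(1) by (simp add: C_def insert_Diff_if)
  qed
  finally show ?case .
qed

section \<open>Coefficients of the Jacobi-Stirling polynomial\<close>

text \<open>Vieta's formula: the factors contributing \<open>X\<close> are indexed by the set \<open>M\<close>.\<close>
lemma coeff_prod_linear_factors:
  fixes a :: "'b \<Rightarrow> 'a::comm_ring_1"
  assumes fin: "finite A"
  shows "coeff (\<Prod>i\<in>A. [:0, 1:] - [:a i:]) j =
    (-1) ^ (card A + j) * (\<Sum>M | M \<subseteq> A \<and> card M = j. \<Prod>i\<in>A - M. a i)"
proof -
  have summand: "coeff ((\<Prod>i\<in>M. [:0, 1:]) * (\<Prod>i\<in>A - M. [:- a i:])) j =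
      (if card M = j then (-1) ^ (card A + j) * (\<Prod>i\<in>A - M. a i) else 0)" if "M \<in> Pow A" for M
  proof -
    have const: "(\<Prod>i\<in>B. [:- a i:]) = [:(-1) ^ card B * (\<Prod>i\<in>B. a i):]" for B
      by (induction B rule: infinite_finite_induct) (auto simp: one_pCons mult_ac)
    have X: "(\<Prod>i\<in>M. [:0, 1::'a:]) = monom 1 (card M)"
      by (simp add: monom_altdef)
    have M: "M \<subseteq> A" "finite M"
      using that fin finite_subset by auto
    then have "card A + card M = card (A - M) + 2 * card M"
      using fin by (simp add: card_Diff_subset card_mono)
    then have "(-1::'a) ^ (card A + card M) = (-1) ^ card (A - M) * ((-1)\<^sup>2) ^ card M"
      by (simp only: power_add power_mult)
    then show ?thesis
      unfolding const X by (auto simp: mult.commute)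
  qed
  have "(\<Prod>i\<in>A. [:0, 1:] - [:a i:]) = (\<Prod>i\<in>A. [:0, 1:] + [:- a i:])"
    by simp
  also have "\<dots> = (\<Sum>M\<in>Pow A. (\<Prod>i\<in>M. [:0, 1:]) * (\<Prod>i\<in>A - M. [:- a i:]))"
    using fin by (rule prod_add)
  finally have "coeff (\<Prod>i\<in>A. [:0, 1:] - [:a i:]) j =
      (\<Sum>M\<in>Pow A. coeff ((\<Prod>i\<in>M. [:0, 1:]) * (\<Prod>i\<in>A - M. [:- a i:])) j)"
    by (simp only: coeff_sum)
  also have "\<dots> = (\<Sum>M\<in>Pow A. if card M = j then (-1) ^ (card A + j) * (\<Prod>i\<in>A - M. a i) else 0)"
    using summand by (intro sum.cong) auto
  also have "\<dots> = (\<Sum>M | M \<in> Pow A \<and> card M = j. (-1) ^ (card A + j) * (\<Prod>i\<in>A - M. a i))"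
    using fin by (intro sum.inter_filter[symmetric]) simp
  finally show ?thesis
    by (simp add: sum_distrib_left)
qed

lemma jacobi_stirling1_eq_sum_prod:
  "jacobi_stirling1 \<gamma> n j = (\<Sum>M | M \<subseteq> {1..n} \<and> card M = j.
     \<Prod>i\<in>{1..n} - M. of_nat (n - i) * (of_nat (n - i) + 2 * \<gamma> - 1))"
proof -
  have "jacobi_stirling_poly \<gamma> n =
      (\<Prod>i\<in>{1..n}. [:0, 1:] - [:of_nat (n - i) * (of_nat (n - i) + 2 * \<gamma> - 1):])"
    unfolding jacobi_stirling_poly_def
    by (rule prod.reindex_bij_witness[of _ "\<lambda>i. n - i" "\<lambda>m. n - m"]) auto
  then show ?thesis
    unfolding jacobi_stirling1_def
    by (simp only: coeff_prod_linear_factors finite_atLeastAtMost card_atLeastAtMost)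
       (simp flip: mult.assoc power_add)
qed

section \<open>Counting the pairs\<close>

text \<open>
  The difference between the numbers of cycles equals the number of ground set elements above
  \<open>n\<close>, so it forces each of them to be a cycle maximum.
\<close>
lemma unbalanced_pair_conditions_iff:
  fixes n r :: nat
  assumes p1: "\<pi>1 permutes {1..n + r}" and p2: "\<pi>2 permutes {1..n}"
  shows "card (cycles_on {1..n + r} \<pi>1) = card (cycles_on {1..n} \<pi>2) + r \<and>
      {i \<in> cycle_maxima_on {1..n + r} \<pi>1. i < n + 1} = cycle_maxima_on {1..n} \<pi>2
    \<longleftrightarrow> cycle_maxima_on {1..n + r} \<pi>1 = cycle_maxima_on {1..n} \<pi>2 \<union> {n + 1..n + r}"
proof -
  define M1 where "M1 = cycle_maxima_on {1..n + r} \<pi>1"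
  define M2 where "M2 = cycle_maxima_on {1..n} \<pi>2"
  have sub: "M1 \<subseteq> {1..n + r}" "M2 \<subseteq> {1..n}"
    unfolding M1_def M2_def by (rule cycle_maxima_on_subset)+
  have fin: "finite M1" "finite M2"
    using sub finite_subset by auto
  have card_cycles: "card (cycles_on {1..n + r} \<pi>1) = card M1"
      "card (cycles_on {1..n} \<pi>2) = card M2"
    unfolding M1_def M2_def
    using card_cycles_on_eq_card_cycle_maxima_on[OF p1] card_cycles_on_eq_card_cycle_maxima_on[OF p2]
    by simp_all
  have "card M1 = card M2 + r \<and> {i \<in> M1. i < n + 1} = M2 \<longleftrightarrow> M1 = M2 \<union> {n + 1..n + r}"
  proof
    assume *: "card M1 = card M2 + r \<and> {i \<in> M1. i < n + 1} = M2"
    let ?H = "{i \<in> M1. n < i}"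
    have M1: "M1 = M2 \<union> ?H" and disj: "M2 \<inter> ?H = {}"
      using * by auto
    have "card M1 = card M2 + card ?H"
      using card_Un_disjoint[OF fin(2) _ disj] fin(1) M1 by simp
    with * have "card ?H = card {n + 1..n + r}"
      by simp
    moreover have "?H \<subseteq> {n + 1..n + r}"
      using sub by auto
    ultimately have "?H = {n + 1..n + r}"
      by (intro card_subset_eq) auto
    with M1 show "M1 = M2 \<union> {n + 1..n + r}"
      by simp
  next
    assume *: "M1 = M2 \<union> {n + 1..n + r}"
    moreover have disj: "M2 \<inter> {n + 1..n + r} = {}"
      using sub by auto
    ultimately have "card M1 = card M2 + r"
      using fin card_Un_disjoint[of M2 "{n + 1..n + r}"] by simp
    moreover have "{i \<in> M1. i < n + 1} = M2"
      using * sub by auto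
    ultimately show "card M1 = card M2 + r \<and> {i \<in> M1. i < n + 1} = M2"
      by blast
  qed
  then show ?thesis
    unfolding card_cycles M1_def[symmetric] M2_def[symmetric] .
qed

theorem theorem6p2:
  fixes n j \<gamma> :: nat
  assumes "\<gamma> \<ge> 1"
  shows "int (card {(\<pi>1, \<pi>2) \<in> unbalanced_jacobi_stirling_pairs \<gamma> n.
                     card (cycles_on {1..n} \<pi>2) = j})
         = jacobi_stirling1 (int \<gamma>) n j"
proof -
  define r where "r = 2 * \<gamma> - 1"
  have r: "n + 2 * \<gamma> - 1 = n + r" "int r = 2 * int \<gamma> - 1"
    using assms by (auto simp: r_def)
  let ?P1 = "\<lambda>M. {p. p permutes {1..n + r} \<and> cycle_maxima_on {1..n + r} p = M \<union> {n + 1..n + r}}"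
  let ?P2 = "\<lambda>M. {p. p permutes {1..n} \<and> cycle_maxima_on {1..n} p = M}"
  let ?Ms = "{M. M \<subseteq> {1..n} \<and> card M = j}"
  have pairs: "{(\<pi>1, \<pi>2) \<in> unbalanced_jacobi_stirling_pairs \<gamma> n.
      card (cycles_on {1..n} \<pi>2) = j} = (\<Union>M\<in>?Ms. ?P1 M \<times> ?P2 M)" (is "?L = ?R")
  proof -
    have "(\<pi>1, \<pi>2) \<in> ?L \<longleftrightarrow> (\<pi>1, \<pi>2) \<in> ?R" for \<pi>1 \<pi>2
    proof (cases "\<pi>1 permutes {1..n + r} \<and> \<pi>2 permutes {1..n}")
      case True
      then have p1: "\<pi>1 permutes {1..n + r}" and p2: "\<pi>2 permutes {1..n}"
        by blast+
      then have "(\<pi>1, \<pi>2) \<in> ?L \<longleftrightarrow>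
          (card (cycles_on {1..n + r} \<pi>1) = card (cycles_on {1..n} \<pi>2) + r \<and>
           {i \<in> cycle_maxima_on {1..n + r} \<pi>1. i < n + 1} = cycle_maxima_on {1..n} \<pi>2) \<and>
          card (cycles_on {1..n} \<pi>2) = j"
        unfolding unbalanced_jacobi_stirling_pairs_def r(1) r_def[symmetric] mem_Collect_eq prod.case
        by blast
      also have "\<dots> \<longleftrightarrow>
          cycle_maxima_on {1..n + r} \<pi>1 = cycle_maxima_on {1..n} \<pi>2 \<union> {n + 1..n + r} \<and>
          card (cycle_maxima_on {1..n} \<pi>2) = j"
        by (subst unbalanced_pair_conditions_iff[OF p1 p2])
           (simp only: card_cycles_on_eq_card_cycle_maxima_on[OF p2 finite_atLeastAtMost])
      also have "\<dots> \<longleftrightarrow> (\<pi>1, \<pi>2) \<in> ?R"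
        using True cycle_maxima_on_subset[of "{1..n}" \<pi>2] by blast
      finally show ?thesis .
    next
      case False
      then have "(\<pi>1, \<pi>2) \<notin> ?L"
        unfolding unbalanced_jacobi_stirling_pairs_def r(1) mem_Collect_eq prod.case by blast
      moreover have "(\<pi>1, \<pi>2) \<notin> ?R"
        using False by blast
      ultimately show ?thesis
        by (simp only:)
    qed
    then show ?thesis
      by (intro subset_antisym subrelI) (simp_all only:)
  qed
  have card_above: "card {k\<in>{1..m}. i < k} = m - i" for i m :: nat
  proof -
    have "{k\<in>{1..m}. i < k} = {i + 1..m}"
      by auto
    then show ?thesis
      by simp
  qed
  have card_P2: "card (?P2 M) = (\<Prod>i\<in>{1..n} - M. n - i)" if "M \<in> ?Ms" for M
    using card_permutes_cycle_maxima_on[of "{1..n}" M] that unfolding card_above by blast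
  have card_P1: "card (?P1 M) = (\<Prod>i\<in>{1..n} - M. n - i + r)" if "M \<in> ?Ms" for M
  proof -
    have "M \<union> {n + 1..n + r} \<subseteq> {1..n + r}"
      using that by auto
    then have "card (?P1 M) = (\<Prod>i\<in>{1..n + r} - (M \<union> {n + 1..n + r}). n + r - i)"
      using card_permutes_cycle_maxima_on[of "{1..n + r}"] unfolding card_above by blast
    also have "{1..n + r} - (M \<union> {n + 1..n + r}) = {1..n} - M"
      by auto
    also have "(\<Prod>i\<in>{1..n} - M. n + r - i) = (\<Prod>i\<in>{1..n} - M. n - i + r)"
      by (intro prod.cong) auto
    finally show ?thesis .
  qed
  have finite_P: "finite (?P1 M \<times> ?P2 M)" for M
    using finite_permutations[of "{1..n + r}"] finite_permutations[of "{1..n}"]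
    by (intro finite_cartesian_product) (auto elim: rev_finite_subset)
  have "card ?L = (\<Sum>M\<in>?Ms. card (?P1 M \<times> ?P2 M))"
    unfolding pairs
  proof (rule card_UN_disjoint)
    show "finite ?Ms"
      by (rule finite_subset[of _ "Pow {1..n}"]) auto
  qed (use finite_P in auto)
  also have "\<dots> = (\<Sum>M\<in>?Ms. \<Prod>i\<in>{1..n} - M. (n - i) * (n - i + r))"
    by (intro sum.cong refl)
       (simp only: card_cartesian_product card_P1 card_P2 prod.distrib mult.commute)
  finally have "int (card ?L) = (\<Sum>M\<in>?Ms. \<Prod>i\<in>{1..n} - M. int (n - i) * (int (n - i) + int r))"
    by (simp only: of_nat_sum of_nat_prod of_nat_mult of_nat_add)
  also have "\<dots> = jacobi_stirling1 (int \<gamma>) n j"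
    unfolding jacobi_stirling1_eq_sum_prod r(2) by (simp add: algebra_simps)
  finally show ?thesis .
qed

end
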